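(* Let $0<\alpha<1$, let $X(t)=\int_Ef_t(x)\,M(dx)$, $t\in T\subset\mathbb{R}^d$, be an $\alpha$-stable random field, where $M$ is an $\alpha$-stable random measure with control measure $m$ and $\int_E|f_t|^\alpha dm<\infty$ for every $t\in T$. Let $t,t_1,\ldots,t_n\in T$, let $f_{t_1},\ldots,f_{t_n}$ be linearly independent (as elements of $L^\alpha(E,m)$), and let the points $t_1,\ldots,t_n$ be ordered with respect to $t$ as described in the context. Let $$H_\alpha(\lambda)=\Big(\int_E\Big|f_t(x)-\sum_{i=1}^n\lambda_if_{t_i}(x)\Big|^\alpha m(dx)\Big)^{1/\alpha},\quad\lambda\in\mathbb{R}^n,$$ $$A_0=\Big\{\lambda\in\mathbb{R}^n:H_\alpha(\lambda)=\inf_{\mu\in\mathbb{R}^n}H_\alpha(\mu)\Big\},\qquad A_j=\Big\{\lambda\in A_{j-1}:\lambda_j=\max_{\mu\in A_{j-1}}\mu_j\Big\},\quad j=1,\ldots,n.$$ Then the sets $A_1,\ldots,A_n$ are nonempty, and $A_n$ consists of exactly one element.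
   Context: $(E,\mathcal{E},m)$ is a measurable space with $\sigma$-finite measure $m$; an $\alpha$-stable random measure $M$ with control measure $m$ and measurable skewness function $\beta:E\to[-1,1]$ is an independently scattered, a.s. $\sigma$-additive random function on the sets $A$ of finite $m$-measure such that $M(A)$ has the $\alpha$-stable law with scale $m(A)^{1/\alpha}$, skewness $\int_A\beta\,dm/m(A)$ and shift $0$. $H_\alpha(\lambda)$ is the scale parameter of the $\alpha$-stable random variable $\sum_i\lambda_iX(t_i)-X(t)$. Ordering of the points: $\|t-t_1\|\le\|t-t_2\|\le\cdots\le\|t-t_n\|$ (Euclidean norm), and whenever $\|t-t_i\|=\|t-t_{i+1}\|$, the point $t_i$ precedes $t_{i+1}$ lexicographically, i.e. for some $k\in\{1,\ldots,d\}$ one has $t_i^{(p)}=t_{i+1}^{(p)}$ for $p=1,\ldots,k-1$ and $t_i^{(k)}<t_{i+1}^{(k)}$, where $t_i^{(p)}$ is the $p$-th coordinate of $t_i$. *)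

theory Defs
  imports "HOL-Probability.Probability"
begin

text \<open>
  The law \<open>S\<^sub>\<alpha>(\<sigma>,\<beta>,\<mu>)\<close> in the parametrisation of Samorodnitsky and Taqqu. The characteristic
  function has a different form for \<open>\<alpha> = 1\<close>, a value that is excluded here throughout.
\<close>

definition stable_law :: "real \<Rightarrow> real \<Rightarrow> real \<Rightarrow> real \<Rightarrow> real measure \<Rightarrow> bool" where
  "stable_law \<alpha> \<sigma> \<beta> \<mu> N \<longleftrightarrow> real_distribution N \<and>
     (\<forall>\<theta>. char N \<theta> =
        exp (- complex_of_real (\<sigma> powr \<alpha> * \<bar>\<theta>\<bar> powr \<alpha>) *
               (1 - \<i> * complex_of_real (\<beta> * sgn \<theta> * tan (pi * \<alpha> / 2)))
             + \<i> * complex_of_real (\<mu> * \<theta>)))"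

definition in_L :: "real \<Rightarrow> 'e measure \<Rightarrow> ('e \<Rightarrow> real) \<Rightarrow> bool" where
  "in_L \<alpha> m f \<longleftrightarrow> f \<in> borel_measurable m \<and> integrable m (\<lambda>x. \<bar>f x\<bar> powr \<alpha>)"

definition conv_in_prob :: "'w measure \<Rightarrow> (nat \<Rightarrow> 'w \<Rightarrow> real) \<Rightarrow> ('w \<Rightarrow> real) \<Rightarrow> bool" where
  "conv_in_prob P Y Z \<longleftrightarrow>
     (\<forall>\<epsilon>>0. (\<lambda>k. measure P {\<omega> \<in> space P. \<epsilon> < \<bar>Y k \<omega> - Z \<omega>\<bar>}) \<longlonglongrightarrow> 0)"

text \<open>
  In \<open>law\<close>, a set \<open>A\<close> with \<open>m(A) = 0\<close> gets skewness \<open>0 / 0 = 0\<close>; this is harmless, because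
  its scale is \<open>0\<close> and the skewness then does not enter the characteristic function.
\<close>

locale stable_random_measure = prob_space P + E: sigma_finite_measure m
  for P :: "'w measure" and m :: "'e measure" +
  fixes \<alpha> :: real and \<beta> :: "'e \<Rightarrow> real" and M :: "'e set \<Rightarrow> 'w \<Rightarrow> real"
  assumes index: "0 < \<alpha>" "\<alpha> < 2" "\<alpha> \<noteq> 1"
    and skewness_measurable: "\<beta> \<in> borel_measurable m"
    and skewness_range: "\<And>x. x \<in> space m \<Longrightarrow> \<beta> x \<in> {-1..1}"
    and M_measurable: "\<And>A. A \<in> fmeasurable m \<Longrightarrow> M A \<in> borel_measurable P"
    and law: "\<And>A. A \<in> fmeasurable m \<Longrightarrow>
      stable_law \<alpha> (measure m A powr (1 / \<alpha>)) ((LINT x:A|m. \<beta> x) / measure m A) 0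
        (distr P borel (M A))"
    and independently_scattered: "\<And>(A :: nat \<Rightarrow> 'e set) k.
      (\<And>i. i < k \<Longrightarrow> A i \<in> fmeasurable m) \<Longrightarrow> disjoint_family_on A {..<k} \<Longrightarrow>
      indep_vars (\<lambda>_. borel) (\<lambda>i. M (A i)) {..<k}"
    and sigma_additive: "\<And>A :: nat \<Rightarrow> 'e set.
      (\<And>i. A i \<in> fmeasurable m) \<Longrightarrow> disjoint_family A \<Longrightarrow> (\<Union>i. A i) \<in> fmeasurable m \<Longrightarrow>
      AE \<omega> in P. (\<lambda>i. M (A i) \<omega>) sums M (\<Union>i. A i) \<omega>"

definition simple_integrand :: "'e measure \<Rightarrow> ('e \<Rightarrow> real) \<Rightarrow> bool" where
  "simple_integrand m s \<longleftrightarrow>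
     simple_function m s \<and> {x \<in> space m. s x \<noteq> 0} \<in> fmeasurable m"

definition simple_stable_integral ::
  "'e measure \<Rightarrow> ('e set \<Rightarrow> 'w \<Rightarrow> real) \<Rightarrow> ('e \<Rightarrow> real) \<Rightarrow> 'w \<Rightarrow> real" where
  "simple_stable_integral m M s \<omega> =
     (\<Sum>y\<in>s ` space m - {0}. y * M (s -` {y} \<inter> space m) \<omega>)"

text \<open>
  \<open>Y\<close> is a version of the integral of \<open>f\<close> with respect to \<open>M\<close>: the limit in probability of the
  integrals of simple functions that converge to \<open>f\<close> almost everywhere and are dominated in
  \<open>L\<^sup>\<alpha>(E,m)\<close>. The limit does not depend on the approximating sequence up to null sets, so
  the random variable is determined only almost surely; hence a relation.
\<close>

definition stable_integral ::
  "'w measure \<Rightarrow> 'e measure \<Rightarrow> real \<Rightarrow> ('e set \<Rightarrow> 'w \<Rightarrow> real) \<Rightarrow> ('e \<Rightarrow> real) \<Rightarrow> ('w \<Rightarrow> real) \<Rightarrow> bool"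
  where
  "stable_integral P m \<alpha> M f Y \<longleftrightarrow> Y \<in> borel_measurable P \<and>
     (\<exists>(s :: nat \<Rightarrow> 'e \<Rightarrow> real) g.
        (\<forall>k. simple_integrand m (s k)) \<and>
        (AE x in m. (\<lambda>k. s k x) \<longlonglongrightarrow> f x) \<and>
        in_L \<alpha> m g \<and> (\<forall>k. \<forall>x\<in>space m. \<bar>s k x\<bar> \<le> g x) \<and>
        conv_in_prob P (\<lambda>k. simple_stable_integral m M (s k)) Y)"

text \<open>The index type \<open>'d\<close>, a finite linear order, plays the role of \<open>{1,\<dots>,d}\<close>.\<close>

definition lex_less :: "real ^ 'd::{finite, linorder} \<Rightarrow> real ^ 'd::{finite, linorder} \<Rightarrow> bool" where
  "lex_less u v \<longleftrightarrow> (\<exists>k. (\<forall>p<k. u $ p = v $ p) \<and> u $ k < v $ k)"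

definition ordered_points :: "real ^ 'd::{finite, linorder} \<Rightarrow> nat \<Rightarrow> (nat \<Rightarrow> real ^ 'd::{finite, linorder}) \<Rightarrow> bool" where
  "ordered_points t n ti \<longleftrightarrow> (\<forall>i\<in>{1..<n}.
     norm (t - ti i) \<le> norm (t - ti (Suc i)) \<and>
     (norm (t - ti i) = norm (t - ti (Suc i)) \<longrightarrow> lex_less (ti i) (ti (Suc i))))"

definition lin_indep_ae :: "'e measure \<Rightarrow> nat \<Rightarrow> (nat \<Rightarrow> 'e \<Rightarrow> real) \<Rightarrow> bool" where
  "lin_indep_ae m n g \<longleftrightarrow>
     (\<forall>c :: nat \<Rightarrow> real. (AE x in m. (\<Sum>i=1..n. c i * g i x) = 0) \<longrightarrow> (\<forall>i\<in>{1..n}. c i = 0))"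

text \<open>
  Vectors of \<open>\<real>\<^sup>n\<close> are functions on \<open>{1..n}\<close>. They have the fixed value \<open>undefined\<close> outside
  \<open>{1..n}\<close>, so that equality of functions is equality of vectors.
\<close>

abbreviation Rn :: "nat \<Rightarrow> (nat \<Rightarrow> real) set" where
  "Rn n \<equiv> {1..n} \<rightarrow>\<^sub>E UNIV"

definition H_scale ::
  "'e measure \<Rightarrow> real \<Rightarrow> nat \<Rightarrow> ('e \<Rightarrow> real) \<Rightarrow> (nat \<Rightarrow> 'e \<Rightarrow> real) \<Rightarrow> (nat \<Rightarrow> real) \<Rightarrow> real" where
  "H_scale m \<alpha> n f g l =
     (LINT x|m. \<bar>f x - (\<Sum>i=1..n. l i * g i x)\<bar> powr \<alpha>) powr (1 / \<alpha>)"

primrec A_set ::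
  "'e measure \<Rightarrow> real \<Rightarrow> nat \<Rightarrow> ('e \<Rightarrow> real) \<Rightarrow> (nat \<Rightarrow> 'e \<Rightarrow> real) \<Rightarrow> nat \<Rightarrow> (nat \<Rightarrow> real) set" where
  "A_set m \<alpha> n f g 0 =
     {l \<in> Rn n. H_scale m \<alpha> n f g l = (INF u\<in>Rn n. H_scale m \<alpha> n f g u)}"
| "A_set m \<alpha> n f g (Suc j) =
     {l \<in> A_set m \<alpha> n f g j. \<forall>u\<in>A_set m \<alpha> n f g j. u (Suc j) \<le> l (Suc j)}"

end

theory Submission
  imports Defs
begin

text \<open>
  For \<open>\<alpha> \<le> 1\<close> the functional \<open>h \<mapsto> \<integral>|h|\<^sup>\<alpha> dm\<close> is subadditive and homogeneous of degree \<open>\<alpha>\<close>. On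
  the span of the \<open>f\<^sub>t\<^sub>i\<close> it is therefore continuous in the coefficients and, by linear
  independence, bounded below by a positive constant on the unit sphere. Hence \<open>H\<^sub>\<alpha>\<close> is continuous
  and coercive, so \<open>A\<^sub>0\<close> is nonempty and compact, and so is each \<open>A\<^sub>j\<close>, the set of maximisers of a
  coordinate on the compact set \<open>A\<^sub>j\<^sub>-\<^sub>1\<close>. The first \<open>j\<close> coordinates are constant on \<open>A\<^sub>j\<close>, so \<open>A\<^sub>n\<close> has a
  single element. Compactness refers to the product topology on \<open>nat \<Rightarrow> real\<close>.
\<close>

section \<open>Subadditivity of the p-th power mass for 0 < p <= 1\<close>

text \<open>Split \<open>(a + b) powr p\<close> as
  \<open>a * (a + b) powr (p - 1) + b * (a + b) powr (p - 1)\<close>; since p - 1 <= 0, shrinking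
  the base \<open>a + b\<close> to \<open>a\<close> or \<open>b\<close> only increases each
  term.\<close>

lemma powr_add_le_add_powr:
  fixes a b :: real
  assumes "0 \<le> a" "0 \<le> b" "0 < p" "p \<le> 1"
  shows "(a + b) powr p \<le> a powr p + b powr p"
proof (cases "a = 0 \<or> b = 0")
  case False
  then have "a > 0" "b > 0" using assms by auto
  have *: "x * (a + b) powr (p - 1) \<le> x powr p" if "0 < x" "x \<le> a + b" for x
  proof -
    have "(a + b) powr (p - 1) \<le> x powr (p - 1)"
      using that assms by (intro powr_mono2') auto
    then have "x * (a + b) powr (p - 1) \<le> x * x powr (p - 1)"
      using that by (intro mult_left_mono) auto
    also have "\<dots> = x powr p"
      using that powr_mult_base[of x "p - 1"] by simp
    finally show ?thesis .
  qed
  have "(a + b) powr p = (a + b) * (a + b) powr (p - 1)"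
    using \<open>a > 0\<close> \<open>b > 0\<close> powr_mult_base[of "a + b" "p - 1"] by simp
  also have "\<dots> = a * (a + b) powr (p - 1) + b * (a + b) powr (p - 1)"
    by (simp add: algebra_simps)
  also have "\<dots> \<le> a powr p + b powr p"
    using \<open>a > 0\<close> \<open>b > 0\<close> by (intro add_mono *) auto
  finally show ?thesis .
qed auto

lemma abs_add_powr_le:
  fixes a b :: real
  assumes "0 < p" "p \<le> 1"
  shows "\<bar>a + b\<bar> powr p \<le> \<bar>a\<bar> powr p + \<bar>b\<bar> powr p"
proof -
  have "\<bar>a + b\<bar> powr p \<le> (\<bar>a\<bar> + \<bar>b\<bar>) powr p"
    using assms by (intro powr_mono2) auto
  also have "\<dots> \<le> \<bar>a\<bar> powr p + \<bar>b\<bar> powr p"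
    using assms by (intro powr_add_le_add_powr) auto
  finally show ?thesis .
qed

lemma in_L_add:
  assumes "in_L p m f" "in_L p m g" "0 < p" "p \<le> 1"
  shows "in_L p m (\<lambda>x. f x + g x)"
proof -
  have [measurable]: "f \<in> borel_measurable m" "g \<in> borel_measurable m"
    using assms by (auto simp: in_L_def)
  have "integrable m (\<lambda>x. \<bar>f x\<bar> powr p + \<bar>g x\<bar> powr p)"
    using assms by (auto simp: in_L_def)
  then have "integrable m (\<lambda>x. \<bar>f x + g x\<bar> powr p)"
    by (rule Bochner_Integration.integrable_bound)
      (use assms abs_add_powr_le in auto)
  then show ?thesis by (simp add: in_L_def)
qed

lemma in_L_scale:
  assumes "in_L p m f"
  shows "in_L p m (\<lambda>x. c * f x)"
  using assms by (auto simp: in_L_def abs_mult powr_mult)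

lemma in_L_zero: "in_L p m (\<lambda>x. 0)"
  by (auto simp: in_L_def)

lemma in_L_sum:
  assumes "finite I" "\<And>i. i \<in> I \<Longrightarrow> in_L p m (h i)" "0 < p" "p \<le> 1"
  shows "in_L p m (\<lambda>x. \<Sum>i\<in>I. h i x)"
  using assms by (induction I rule: finite_induct) (auto intro: in_L_add in_L_zero)

lemma integral_powr_add_le:
  assumes "in_L p m f" "in_L p m g" "0 < p" "p \<le> 1"
  shows "(LINT x|m. \<bar>f x + g x\<bar> powr p) \<le> (LINT x|m. \<bar>f x\<bar> powr p) + (LINT x|m. \<bar>g x\<bar> powr p)"
proof -
  have "(LINT x|m. \<bar>f x + g x\<bar> powr p) \<le> (LINT x|m. \<bar>f x\<bar> powr p + \<bar>g x\<bar> powr p)"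
    using assms in_L_add[OF assms] by (intro integral_mono abs_add_powr_le) (auto simp: in_L_def)
  then show ?thesis
    using assms by (simp add: in_L_def)
qed

lemma integral_powr_scale:
  fixes c :: real and f :: "'e \<Rightarrow> real"
  shows "(LINT x|m. \<bar>c * f x\<bar> powr p) = \<bar>c\<bar> powr p * (LINT x|m. \<bar>f x\<bar> powr p)"
  by (simp add: abs_mult powr_mult)

lemma integral_powr_sum_le:
  assumes "finite I" "\<And>i. i \<in> I \<Longrightarrow> in_L p m (h i)" "0 < p" "p \<le> 1"
  shows "(LINT x|m. \<bar>\<Sum>i\<in>I. h i x\<bar> powr p) \<le> (\<Sum>i\<in>I. LINT x|m. \<bar>h i x\<bar> powr p)"
  using assms
proof (induction I rule: finite_induct)
  case (insert i I)
  have "(LINT x|m. \<bar>\<Sum>i\<in>insert i I. h i x\<bar> powr p) =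
      (LINT x|m. \<bar>h i x + (\<Sum>i\<in>I. h i x)\<bar> powr p)"
    using insert by simp
  also have "\<dots> \<le> (LINT x|m. \<bar>h i x\<bar> powr p) + (LINT x|m. \<bar>\<Sum>i\<in>I. h i x\<bar> powr p)"
    using insert by (intro integral_powr_add_le in_L_sum) auto
  finally show ?case using insert by auto
qed simp

text \<open>Tychonoff: the box is a product over all of \<open>nat\<close> whose factors outside
  \<open>{1..n}\<close> are the singleton \<open>{undefined}\<close>.\<close>

lemma compact_PiE_interval:
  "compact ({1..n::nat} \<rightarrow>\<^sub>E {- R..R::real})"
proof -
  have eq: "({1..n} \<rightarrow>\<^sub>E {- R..R}) =
      (\<Pi>\<^sub>E i\<in>UNIV. if i \<in> {1..n} then {- R..R} else {undefined})"
    by (auto simp: PiE_def Pi_def extensional_def split: if_splits)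
  have "compactin (product_topology (\<lambda>_. euclidean) UNIV)
      (\<Pi>\<^sub>E i\<in>UNIV. if i \<in> {1..n} then {- R..R} else {undefined})"
    unfolding compactin_PiE by auto
  then show ?thesis
    unfolding eq by (simp add: euclidean_product_topology)
qed

section \<open>Approximation in L^p from a finite-dimensional span\<close>

locale alpha_approximation =
  fixes m :: "'e measure" and p :: real and n :: nat and f :: "'e \<Rightarrow> real"
    and g :: "nat \<Rightarrow> 'e \<Rightarrow> real"
  assumes p: "0 < p" "p \<le> 1"
    and f: "in_L p m f"
    and g: "\<And>i. i \<in> {1..n} \<Longrightarrow> in_L p m (g i)"
    and indep: "lin_indep_ae m n g"
begin

text \<open>The p-th power of the L^p quasi-norm; likewise \<open>error\<close> is the p-th power of
  \<open>H_scale\<close>. Without the outer root the triangle inequality holds with constant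
  1.\<close>

definition comb_mass :: "(nat \<Rightarrow> real) \<Rightarrow> real" where
  "comb_mass l = (LINT x|m. \<bar>\<Sum>i=1..n. l i * g i x\<bar> powr p)"

definition error :: "(nat \<Rightarrow> real) \<Rightarrow> real" where
  "error l = (LINT x|m. \<bar>f x - (\<Sum>i=1..n. l i * g i x)\<bar> powr p)"

lemma in_L_comb: "in_L p m (\<lambda>x. \<Sum>i=1..n. l i * g i x)"
  using p g by (intro in_L_sum in_L_scale) auto

lemma in_L_error: "in_L p m (\<lambda>x. f x - (\<Sum>i=1..n. l i * g i x))"
  using in_L_add[OF f in_L_scale[OF in_L_comb, of "-1"] p] by simp

lemma error_le: "error l \<le> error u + comb_mass (\<lambda>i. u i - l i)"
proof -
  have "f x - (\<Sum>i=1..n. l i * g i x) =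
      (f x - (\<Sum>i=1..n. u i * g i x)) + (\<Sum>i=1..n. (u i - l i) * g i x)" for x
    by (simp add: algebra_simps sum_subtractf)
  then have "error l = (LINT x|m. \<bar>(f x - (\<Sum>i=1..n. u i * g i x)) +
      (\<Sum>i=1..n. (u i - l i) * g i x)\<bar> powr p)"
    unfolding error_def by presburger
  also have "\<dots> \<le> error u + comb_mass (\<lambda>i. u i - l i)"
    unfolding error_def comb_mass_def
    by (rule integral_powr_add_le[OF in_L_error in_L_comb p])
  finally show ?thesis .
qed

lemma comb_mass_scale: "comb_mass (\<lambda>i. c * l i) = \<bar>c\<bar> powr p * comb_mass l"
  unfolding comb_mass_def using integral_powr_scale[of m c "\<lambda>x. \<Sum>i=1..n. l i * g i x" p]
  by (simp add: sum_distrib_left mult.assoc)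

lemma comb_mass_minus: "comb_mass (\<lambda>i. u i - l i) = comb_mass (\<lambda>i. l i - u i)"
  using comb_mass_scale[of "-1" "\<lambda>i. l i - u i"] by simp

text \<open>Writing the combination as f minus its residual transfers coercivity from
  \<open>comb_mass\<close> to \<open>error\<close>.\<close>

lemma comb_mass_le_error: "comb_mass l \<le> error l + error (\<lambda>_. 0)"
proof -
  have "comb_mass l = (LINT x|m. \<bar>f x + (-1) * (f x - (\<Sum>i=1..n. l i * g i x))\<bar> powr p)"
    by (simp add: comb_mass_def)
  also have "\<dots> \<le> error (\<lambda>_. 0) + (LINT x|m. \<bar>(-1) * (f x - (\<Sum>i=1..n. l i * g i x))\<bar> powr p)"
    unfolding error_def using integral_powr_add_le[OF f in_L_scale[OF in_L_error] p, of "-1" l]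
    by simp
  also have "\<dots> = error l + error (\<lambda>_. 0)"
    unfolding integral_powr_scale by (simp add: error_def)
  finally show ?thesis .
qed

lemma comb_mass_le: "comb_mass l \<le> (\<Sum>i=1..n. \<bar>l i\<bar> powr p * (LINT x|m. \<bar>g i x\<bar> powr p))"
  unfolding comb_mass_def integral_powr_scale[symmetric]
  using p g by (intro integral_powr_sum_le in_L_scale) auto

text \<open>Using the hypothesis in both directions bounds \<open>\<bar>F u - F l\<bar>\<close> by
  \<open>comb_mass\<close> of the difference, hence by a continuous function of finitely many
  coordinates that vanishes at \<open>l\<close>.\<close>

lemma continuous_of_comb_mass_bound:
  assumes "\<And>l u. F l \<le> F u + comb_mass (\<lambda>i. u i - l i)"
  shows "continuous_on S (F :: (nat \<Rightarrow> real) \<Rightarrow> real)"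
  unfolding continuous_on_def
proof
  fix l assume "l \<in> S"
  let ?B = "\<lambda>u. \<Sum>i=1..n. \<bar>u i - l i\<bar> powr p * (LINT x|m. \<bar>g i x\<bar> powr p)"
  have "continuous_on S ?B"
    using p by (intro continuous_intros continuous_on_powr' continuous_on_subset[OF continuous_on_product_coordinates]) auto
  then have "(?B \<longlongrightarrow> ?B l) (at l within S)"
    using \<open>l \<in> S\<close> by (auto simp: continuous_on_def)
  then have lim: "(?B \<longlongrightarrow> 0) (at l within S)"
    by simp
  have "norm (F u - F l) \<le> ?B u" for u
    using assms[of l u] assms[of u l] comb_mass_minus[of u l] comb_mass_le[of "\<lambda>i. u i - l i"] by simp
  then have "\<forall>\<^sub>F u in at l within S. norm (F u - F l) \<le> ?B u"
    by (intro always_eventually allI)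
  then have "((\<lambda>u. F u - F l) \<longlongrightarrow> 0) (at l within S)"
    using lim by (rule Lim_null_comparison)
  then show "(F \<longlongrightarrow> F l) (at l within S)"
    by (rule LIM_zero_cancel)
qed

lemma continuous_error: "continuous_on S error"
  by (rule continuous_of_comb_mass_bound) (rule error_le)

lemma continuous_comb_mass: "continuous_on S comb_mass"
proof (rule continuous_of_comb_mass_bound)
  fix l u
  have "comb_mass l = (LINT x|m. \<bar>(\<Sum>i=1..n. u i * g i x) + (\<Sum>i=1..n. (l i - u i) * g i x)\<bar> powr p)"
    by (simp add: comb_mass_def sum.distrib[symmetric] algebra_simps)
  also have "\<dots> \<le> comb_mass u + comb_mass (\<lambda>i. l i - u i)"
    unfolding comb_mass_def by (rule integral_powr_add_le[OF in_L_comb in_L_comb p])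
  finally show "comb_mass l \<le> comb_mass u + comb_mass (\<lambda>i. u i - l i)"
    by (subst comb_mass_minus)
qed

section \<open>Coercivity on the span\<close>

text \<open>Linear independence enters here: zero mass would make the combination vanish almost
  everywhere.\<close>

lemma comb_mass_pos:
  assumes "i \<in> {1..n}" "l i \<noteq> 0"
  shows "0 < comb_mass l"
proof -
  have "comb_mass l \<noteq> 0"
  proof
    assume "comb_mass l = 0"
    then have "AE x in m. \<bar>\<Sum>i=1..n. l i * g i x\<bar> powr p = 0"
      unfolding comb_mass_def using in_L_comb[of l]
      by (subst (asm) integral_nonneg_eq_0_iff_AE) (auto simp: in_L_def)
    then have "AE x in m. (\<Sum>i=1..n. l i * g i x) = 0"
      by simp
    then show False
      using indep assms by (auto simp: lin_indep_ae_def)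
  qed
  moreover have "0 \<le> comb_mass l"
    by (simp add: comb_mass_def)
  ultimately show ?thesis by simp
qed

text \<open>The constant is a positive lower bound of \<open>comb_mass\<close> on the compact l1
  unit sphere; homogeneity of degree p extends the bound to all vectors.\<close>

lemma comb_mass_coercive:
  obtains c where "c > 0" "\<And>l. c * (\<Sum>i=1..n. \<bar>l i\<bar>) powr p \<le> comb_mass l"
proof -
  \<comment> \<open>The box adds no constraint on the coordinates in \<open>{1..n}\<close>; it
    supplies compactness and fixes the values elsewhere.\<close>
  define S where "S = ({1..n} \<rightarrow>\<^sub>E {-1..1}) \<inter> {l. (\<Sum>i=1..n. \<bar>l i\<bar>) = (1::real)}"
  have "closed {l. (\<Sum>i=1..n. \<bar>l i\<bar>) = (1::real)}"
    by (intro closed_Collect_eq continuous_intros) auto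
  then have "compact S"
    unfolding S_def using compact_PiE_interval by (intro compact_Int_closed)
  have pos: "0 < comb_mass l" if "l \<in> S" for l
  proof -
    have "\<exists>i\<in>{1..n}. l i \<noteq> 0"
      using that by (auto simp: S_def intro: ccontr)
    then show ?thesis using comb_mass_pos by blast
  qed
  obtain c where c: "c > 0" "\<And>l. l \<in> S \<Longrightarrow> c \<le> comb_mass l"
  \<comment> \<open>\<open>S\<close> is empty exactly when n = 0; any positive constant then
    serves.\<close>
  proof (cases "S = {}")
    case False
    then obtain l where "l \<in> S" "\<And>u. u \<in> S \<Longrightarrow> comb_mass l \<le> comb_mass u"
      using continuous_attains_inf[OF \<open>compact S\<close> _ continuous_comb_mass] by metis
    then show ?thesis using that pos by blast
  qed (use that[of 1] in auto)
  have "c * (\<Sum>i=1..n. \<bar>l i\<bar>) powr p \<le> comb_mass l" for l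
  proof (cases "(\<Sum>i=1..n. \<bar>l i\<bar>) = 0")
    case True
    then show ?thesis by (simp add: comb_mass_def)
  next
    case False
    define s where "s = (\<Sum>i=1..n. \<bar>l i\<bar>)"
    have s: "s > 0"
      using False sum_nonneg[of "{1..n}" "\<lambda>i. \<bar>l i\<bar>"] unfolding s_def by linarith
    \<comment> \<open>The restriction puts \<open>v\<close> into the extensional set
      \<open>S\<close>; \<open>comb_mass\<close> reads only the coordinates in
      \<open>{1..n}\<close>, so it does not notice.\<close>
    define v where "v = (\<lambda>i\<in>{1..n}. l i / s)"
    have le: "\<bar>l i\<bar> \<le> s" if "i \<in> {1..n}" for i
      unfolding s_def using that by (intro member_le_sum) auto
    have "(\<Sum>i=1..n. \<bar>v i\<bar>) = (\<Sum>i=1..n. \<bar>l i\<bar> / s)"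
      using s by (intro sum.cong) (auto simp: v_def)
    also have "\<dots> = 1"
      using s by (simp add: sum_divide_distrib[symmetric] s_def)
    finally have "v \<in> S"
      using le s by (fastforce simp: S_def v_def abs_le_iff field_simps)
    have "comb_mass l = comb_mass (\<lambda>i. s * v i)"
      unfolding comb_mass_def using s
      by (intro Bochner_Integration.integral_cong refl arg_cong[where f = "\<lambda>y. \<bar>y\<bar> powr p"] sum.cong)
        (auto simp: v_def)
    also have "\<dots> = s powr p * comb_mass v"
      using s by (simp add: comb_mass_scale)
    also have "\<dots> \<ge> s powr p * c"
      using c(2)[OF \<open>v \<in> S\<close>] by (intro mult_left_mono) auto
    finally show ?thesis by (simp add: s_def mult.commute)
  qed
  then show ?thesis using that c(1) by blast
qed

text \<open>Every minimiser does at least as well as the zero vector, so the search can be confined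
  to a compact box.\<close>

lemma error_zero_bounded:
  obtains R where "\<And>l. l \<in> Rn n \<Longrightarrow> error l \<le> error (\<lambda>_. 0) \<Longrightarrow> l \<in> {1..n} \<rightarrow>\<^sub>E {- R..R}"
proof -
  obtain c where c: "c > 0" "\<And>l. c * (\<Sum>i=1..n. \<bar>l i\<bar>) powr p \<le> comb_mass l"
    using comb_mass_coercive by blast
  \<comment> \<open>This \<open>R\<close> solves
    \<open>c * R powr p = 2 * error (\<lambda>_. 0)\<close>, the bound that coercivity and
    \<open>comb_mass_le_error\<close> give on this sublevel set.\<close>
  define R where "R = (2 * error (\<lambda>_. 0) / c) powr (1 / p)"
  have "l \<in> {1..n} \<rightarrow>\<^sub>E {- R..R}" if "l \<in> Rn n" "error l \<le> error (\<lambda>_. 0)" for l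
  proof -
    let ?s = "\<Sum>i=1..n. \<bar>l i\<bar>"
    have "c * ?s powr p \<le> 2 * error (\<lambda>_. 0)"
      using c(2)[of l] comb_mass_le_error[of l] that by linarith
    then have "?s powr p \<le> 2 * error (\<lambda>_. 0) / c"
      using c(1) by (simp add: field_simps)
    then have "(?s powr p) powr (1 / p) \<le> R"
      unfolding R_def using p by (intro powr_mono2) auto
    then have "?s \<le> R"
      using p by (simp add: powr_powr sum_nonneg)
    moreover have "\<bar>l i\<bar> \<le> ?s" if "i \<in> {1..n}" for i
      using that by (intro member_le_sum) auto
    ultimately have "l i \<in> {- R..R}" if "i \<in> {1..n}" for i
      using that by fastforce
    then show ?thesis
      using that by (auto simp: PiE_iff)
  qed
  then show ?thesis using that by blast
qed

section \<open>Nonemptiness and compactness of the sets \<open>A_set\<close>\<close>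

lemma H_scale_le_iff: "H_scale m p n f g l \<le> H_scale m p n f g u \<longleftrightarrow> error l \<le> error u"
proof -
  have "0 \<le> error v" for v
    by (simp add: error_def)
  then have "error l powr (1 / p) \<le> error u powr (1 / p) \<longleftrightarrow> error l \<le> error u"
    using p by (meson linorder_not_le powr_less_mono2 powr_mono2 zero_less_divide_1_iff less_imp_le)
  then show ?thesis
    by (simp add: H_scale_def error_def)
qed

text \<open>\<open>H_scale\<close> is bounded below by 0, so the real \<open>INF\<close> is a
  genuine infimum, and attaining it means minimising \<open>error\<close>.\<close>

lemma A_set_0_eq: "A_set m p n f g 0 = {l \<in> Rn n. \<forall>u\<in>Rn n. error l \<le> error u}"
proof -
  let ?H = "H_scale m p n f g"
  have bdd: "bdd_below (?H ` Rn n)"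
    by (rule bdd_belowI[where m = 0]) (auto simp: H_scale_def)
  have "?H l = (INF u\<in>Rn n. ?H u) \<longleftrightarrow> (\<forall>u\<in>Rn n. ?H l \<le> ?H u)" if "l \<in> Rn n" for l
  proof
    assume "?H l = (INF u\<in>Rn n. ?H u)"
    then show "\<forall>u\<in>Rn n. ?H l \<le> ?H u"
      using cINF_lower[OF bdd] by simp
  next
    assume "\<forall>u\<in>Rn n. ?H l \<le> ?H u"
    then show "?H l = (INF u\<in>Rn n. ?H u)"
      using that by (intro antisym cINF_greatest cINF_lower[OF bdd]) auto
  qed
  then show ?thesis
    unfolding H_scale_le_iff by auto
qed

lemma compact_A_set_0: "compact (A_set m p n f g 0) \<and> A_set m p n f g 0 \<noteq> {}"
proof -
  obtain R where R: "\<And>l. l \<in> Rn n \<Longrightarrow> error l \<le> error (\<lambda>_. 0) \<Longrightarrow> l \<in> {1..n} \<rightarrow>\<^sub>E {- R..R}"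
    using error_zero_bounded by blast
  let ?K = "{1..n} \<rightarrow>\<^sub>E {- R..R}"
  \<comment> \<open>The constant zero function is not extensional; its restriction represents the
    zero vector and has the same error.\<close>
  have z: "(\<lambda>i\<in>{1..n}. 0) \<in> Rn n" "error (\<lambda>i\<in>{1..n}. 0) = error (\<lambda>_. 0)"
    by (auto simp: error_def)
  then have "?K \<noteq> {}" using R by (metis empty_iff order_refl)
  then obtain l where l: "l \<in> ?K" "\<And>u. u \<in> ?K \<Longrightarrow> error l \<le> error u"
    using continuous_attains_inf[OF compact_PiE_interval _ continuous_error] by metis
  have sub: "?K \<subseteq> Rn n" by (intro PiE_mono) auto
  \<comment> \<open>A minimiser over the box is global: a vector doing worse than zero loses to
    zero, which lies in the box.\<close>
  have min: "error l \<le> error u" if "u \<in> Rn n" for u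
  proof (cases "error u \<le> error (\<lambda>_. 0)")
    case True
    then show ?thesis using l R that by blast
  next
    case False
    then show ?thesis using l(2)[OF R[OF z(1)]] z(2) by simp
  qed
  \<comment> \<open>As a sublevel set of a continuous function inside a compact box, the set is
    compact.\<close>
  have eq: "A_set m p n f g 0 = ?K \<inter> {u. error u \<le> error l}"
  proof (intro equalityI subsetI)
    fix u assume "u \<in> A_set m p n f g 0"
    then have u: "u \<in> Rn n" "\<And>v. v \<in> Rn n \<Longrightarrow> error u \<le> error v"
      unfolding A_set_0_eq by auto
    then show "u \<in> ?K \<inter> {u. error u \<le> error l}"
      using R[OF u(1)] u(2)[OF z(1)] u(2)[of l] z(2) l(1) sub by auto
  next
    fix u assume "u \<in> ?K \<inter> {u. error u \<le> error l}"
    then show "u \<in> A_set m p n f g 0"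
      unfolding A_set_0_eq using sub min by (auto intro: order_trans)
  qed
  have "closed {u. error u \<le> error l}"
    by (intro closed_Collect_le continuous_error continuous_on_const)
  then have "compact (A_set m p n f g 0)"
    unfolding eq by (intro compact_Int_closed compact_PiE_interval)
  moreover have "l \<in> A_set m p n f g 0"
    unfolding eq using l by auto
  ultimately show ?thesis by blast
qed

text \<open>A coordinate is continuous, so it attains its maximum on a nonempty compact set, and the
  maximisers form a closed superlevel set. For indices beyond n the coordinate is constantly
  \<open>undefined\<close>.\<close>

lemma compact_A_set: "compact (A_set m p n f g j) \<and> A_set m p n f g j \<noteq> {}"
proof (induction j)
  case 0
  then show ?case by (rule compact_A_set_0)
next
  case (Suc j)
  let ?A = "A_set m p n f g j"
  have cont: "continuous_on S (\<lambda>l :: nat \<Rightarrow> real. l (Suc j))" for S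
    by (rule continuous_on_subset[OF continuous_on_product_coordinates]) auto
  obtain l where l: "l \<in> ?A" "\<And>u. u \<in> ?A \<Longrightarrow> u (Suc j) \<le> l (Suc j)"
    using continuous_attains_sup[OF _ _ cont] Suc by metis
  have eq: "A_set m p n f g (Suc j) = ?A \<inter> {u. l (Suc j) \<le> u (Suc j)}"
    using l by (auto intro: order_trans)
  have "closed {u :: nat \<Rightarrow> real. l (Suc j) \<le> u (Suc j)}"
    by (intro closed_Collect_le cont continuous_on_const)
  then show ?case
    unfolding eq using Suc l by (auto intro!: compact_Int_closed)
qed

end

section \<open>Uniqueness by successive coordinates\<close>

lemma A_set_subset_Rn: "A_set m p n f g j \<subseteq> Rn n"
  by (induction j) auto

text \<open>Two maximisers of coordinate i over the same set agree there, and later sets are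
  subsets, so the agreement persists.\<close>

lemma A_set_coordinate_unique:
  assumes "l \<in> A_set m p n f g j" "u \<in> A_set m p n f g j" "i \<in> {1..j}"
  shows "l i = u i"
  using assms
proof (induction j)
  case (Suc j)
  show ?case
  proof (cases "i = Suc j")
    case True
    then show ?thesis using Suc.prems by (auto intro: antisym)
  qed (use Suc in auto)
qed simp

text \<open>After n steps all coordinates in \<open>{1..n}\<close> are fixed; extensionality settles
  the other arguments.\<close>

lemma A_set_unique:
  assumes "l \<in> A_set m p n f g n" "u \<in> A_set m p n f g n"
  shows "l = u"
proof (rule PiE_ext)
  show "l \<in> Rn n" "u \<in> Rn n" using assms A_set_subset_Rn by blast+
qed (rule A_set_coordinate_unique[OF assms])

theorem mainTheorem7:
  fixes P :: "'w measure" and m :: "'e measure" and \<alpha> :: real and \<beta> :: "'e \<Rightarrow> real"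
    and M :: "'e set \<Rightarrow> 'w \<Rightarrow> real"
    and T :: "(real ^ 'd::{finite, linorder}) set"
    and f :: "real ^ 'd::{finite, linorder} \<Rightarrow> 'e \<Rightarrow> real" and X :: "real ^ 'd::{finite, linorder} \<Rightarrow> 'w \<Rightarrow> real"
    and n :: nat and t :: "real ^ 'd::{finite, linorder}" and ti :: "nat \<Rightarrow> real ^ 'd::{finite, linorder}"
  assumes "0 < \<alpha>" and "\<alpha> < 1"
    and "stable_random_measure P m \<alpha> \<beta> M"
    and "\<And>s. s \<in> T \<Longrightarrow> in_L \<alpha> m (f s)"
    and "\<And>s. s \<in> T \<Longrightarrow> stable_integral P m \<alpha> M (f s) (X s)"
    and "1 \<le> n" and "t \<in> T" and "\<And>i. i \<in> {1..n} \<Longrightarrow> ti i \<in> T"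
    and "lin_indep_ae m n (\<lambda>i. f (ti i))"
    and "ordered_points t n ti"
  shows "(\<forall>j\<in>{1..n}. A_set m \<alpha> n (f t) (\<lambda>i. f (ti i)) j \<noteq> {}) \<and>
    (\<exists>!l. l \<in> A_set m \<alpha> n (f t) (\<lambda>i. f (ti i)) n)"
proof -
  interpret alpha_approximation m \<alpha> n "f t" "\<lambda>i. f (ti i)"
    using assms by unfold_locales auto
  show ?thesis
    using compact_A_set A_set_unique by blast
qed

end
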